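(* Let $X_1,\dots,X_n$ be an i.i.d. sample from a continuous distribution function $F$, let $X$ be a random variable with distribution function $F_X=F$ and quantile function $q_X$, and let $X_{(1)}\le\cdots\le X_{(n)}$ be the order statistics of the sample. Then for each $i\in\{1,\dots,n\}$ the expected probability loss $$p\longmapsto E\{\delta_X(X_{(i)},q_X(p))\},\qquad p\in[0,1],$$ is minimized uniquely by $p=p_i:=\mathrm{Med}\{\mathrm{Beta}(i,n+1-i)\}$. Moreover, $p_i$ is the solution $u\in[0,1]$ of the equation $$\sum_{j=i}^n\binom{n}{j}u^j(1-u)^{n-j}=\frac12,$$ and $p_i=1-p_{n-i+1}$ for every $i\in\{1,\dots,n\}$.
   Context: $\mathrm{Beta}(\alpha,\beta)$ is the distribution on $[0,1]$ with density $\frac{\Gamma(\alpha+\beta)}{\Gamma(\alpha)\Gamma(\beta)}x^{\alpha-1}(1-x)^{\beta-1}$, and $\mathrm{Med}$ denotes its median. "Continuous distribution function" means that $F$ is continuous on $\mathbb{R}$. The quantile function $q_X$ is the inverse of $F_X$; when $F_X$ is not strictly increasing it is understood as $q_X(p)=\inf\{x: F_X(x)\ge p\}$, with values in the extended reals and the conventions $F_X(-\infty)=0$, $F_X(+\infty)=1$. The probability loss function of a random variable $X$ is $$\delta_X(a,b):=P(a<X<b)+P(b<X<a),$$ which equals $|F_X(b)-F_X(a)|$ when $F_X$ is continuous. It depends on $X$ only through $F_X$. When applied to a random argument $D$ (a function of the sample), $\delta_X(D,b)$ is the random variable obtained by substituting the value of $D$ into the function $\delta_X(\cdot,b)$, so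 here $\delta_X(X_{(i)},q_X(p))=|F_X(X_{(i)})-F_X(q_X(p))|$; the expectation is over the sample. *)

theory Defs
  imports "HOL-Probability.Probability"
begin

text \<open>The \<open>powr\<close> convention \<open>0 powr 0 = 0\<close> and the values at 0 and 1 only concern a Lebesgue null set.\<close>

definition beta_density :: "real \<Rightarrow> real \<Rightarrow> real \<Rightarrow> real" where
  "beta_density \<alpha> \<beta> x =
     (if x \<in> {0..1}
      then Gamma (\<alpha> + \<beta>) / (Gamma \<alpha> * Gamma \<beta>) * x powr (\<alpha> - 1) * (1 - x) powr (\<beta> - 1)
      else 0)"

definition beta_distribution :: "real \<Rightarrow> real \<Rightarrow> real measure" where
  "beta_distribution \<alpha> \<beta> = density lborel (\<lambda>x. ennreal (beta_density \<alpha> \<beta> x))"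

definition is_median :: "real measure \<Rightarrow> real \<Rightarrow> bool" where
  "is_median \<mu> m \<longleftrightarrow> measure \<mu> {..m} \<ge> 1 / 2 \<and> measure \<mu> {m..} \<ge> 1 / 2"

text \<open>Only meaningful for distributions whose median is unique, such as the Beta distributions.\<close>

definition Med :: "real measure \<Rightarrow> real" where
  "Med \<mu> = (THE m. is_median \<mu> m)"

text \<open>
  The infimum is taken in the extended reals, so that it is \<open>-\<infinity>\<close> for \<open>p = 0\<close>,
  and \<open>\<infinity>\<close> for \<open>p = 1\<close> if \<open>F\<close> does not attain the value 1.
\<close>

definition quantile :: "(real \<Rightarrow> real) \<Rightarrow> real \<Rightarrow> ereal" where
  "quantile F p = (INF x\<in>{x. F x \<ge> p}. ereal x)"

text \<open>
  The arguments are extended reals because quantiles can be infinite. As \<open>X\<close> is real-valued,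
  an infinite argument amounts to the conventions \<open>F(-\<infinity>) = 0\<close> and \<open>F(\<infinity>) = 1\<close>.
\<close>

definition prob_loss :: "'b measure \<Rightarrow> ('b \<Rightarrow> real) \<Rightarrow> ereal \<Rightarrow> ereal \<Rightarrow> real" where
  "prob_loss N X a b =
     measure N {\<omega> \<in> space N. a < ereal (X \<omega>) \<and> ereal (X \<omega>) < b} +
     measure N {\<omega> \<in> space N. b < ereal (X \<omega>) \<and> ereal (X \<omega>) < a}"

text \<open>
  The sample is \<open>Xs 1, \<dots>, Xs n\<close>, and the order statistics are likewise indexed
  by \<open>i \<in> {1..n}\<close>, whereas list positions start at 0.
\<close>

definition order_statistic :: "nat \<Rightarrow> (nat \<Rightarrow> 'a \<Rightarrow> real) \<Rightarrow> nat \<Rightarrow> 'a \<Rightarrow> real" where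
  "order_statistic n Xs i \<omega> = sort (map (\<lambda>k. Xs k \<omega>) [1..<Suc n]) ! (i - 1)"

definition expected_prob_loss ::
  "'a measure \<Rightarrow> nat \<Rightarrow> (nat \<Rightarrow> 'a \<Rightarrow> real) \<Rightarrow> 'b measure \<Rightarrow> ('b \<Rightarrow> real) \<Rightarrow> nat \<Rightarrow> real \<Rightarrow> real" where
  "expected_prob_loss M n Xs N X i p =
     (\<integral>\<omega>. prob_loss N X (ereal (order_statistic n Xs i \<omega>))
              (quantile (cdf (distr N borel X)) p) \<partial>M)"

end

theory Submission
  imports Defs
begin

text \<open>
  The loss at \<open>p\<close> is an absolute deviation. By continuity, \<open>F (q\<^sub>X p) = p\<close>
  for every \<open>p \<in> [0,1]\<close>, with \<open>F (-\<infinity>) = 0\<close> and \<open>F \<infinity> = 1\<close> at infinite quantiles, so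
  \<open>\<delta>\<^sub>X (X\<^sub>(\<^sub>i\<^sub>), q\<^sub>X p) = \<bar>U - p\<bar>\<close> with \<open>U = F (X\<^sub>(\<^sub>i\<^sub>))\<close>
  (\<open>prob_loss_quantile\<close>). The expectation of \<open>\<bar>U - p\<bar>\<close> is minimal exactly at the medians of
  \<open>U\<close>, so it remains to see that \<open>U\<close> has the distribution \<open>Beta(i, n + 1 - i)\<close>, and that its
  median is unique.

  Both facts come from one polynomial, the binomial tail
  \<open>G u = (\<Sum>j=i..n. (n choose j) * u ^ j * (1 - u) ^ (n - j))\<close>.
  On the one hand, \<open>X\<^sub>(\<^sub>i\<^sub>) \<le> x\<close> says that at least \<open>i\<close> of the \<open>n\<close> independent events
  \<open>X\<^sub>k \<le> x\<close> occur, and choosing \<open>x\<close> with \<open>F x = u\<close> gives \<open>P(U \<le> u) = G u\<close>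
  (\<open>prob_order_statistic_le\<close>, \<open>continuous_cdf_level\<close>). On the other hand, the derivative of \<open>G\<close>
  telescopes to the Beta density (\<open>DERIV_binomial_tail\<close>), so \<open>G\<close> is also the Beta distribution
  function on \<open>[0,1]\<close> (\<open>measure_beta_distribution\<close>). As the density is positive on \<open>(0,1)\<close>,
  \<open>G\<close> increases strictly from 0 to 1, and the median is the only solution of \<open>G u = 1 / 2\<close>.
  Exchanging successes and failures turns \<open>G\<close> into the complementary tail
  (\<open>binomial_tail_reflect\<close>), which gives the symmetry of the medians.
\<close>

section \<open>Binomial tails as polynomials in the success probability\<close>

definition binomial_tail :: "nat \<Rightarrow> nat \<Rightarrow> real \<Rightarrow> real" where
  "binomial_tail n i u = (\<Sum>j=i..n. real (n choose j) * u ^ j * (1 - u) ^ (n - j))"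

lemma binomial_tail_Suc:
  assumes "i \<le> n"
  shows "binomial_tail n i u
    = real (n choose i) * u ^ i * (1 - u) ^ (n - i) + binomial_tail n (Suc i) u"
  using assms by (simp add: binomial_tail_def sum.atLeast_Suc_atMost)

lemma binomial_tail_all: "binomial_tail n 0 u = 1"
  using binomial_ring[of u "1 - u" n]
  by (simp add: binomial_tail_def atLeast0AtMost)

lemma binomial_tail_at_0: "1 \<le> i \<Longrightarrow> binomial_tail n i 0 = 0"
  by (simp add: binomial_tail_def)

lemma binomial_tail_at_1:
  assumes "i \<le> n" shows "binomial_tail n i 1 = 1"
proof -
  have "binomial_tail n i 1 = (\<Sum>j=i..n. if j = n then 1 else 0)"
    unfolding binomial_tail_def by (intro sum.cong refl) auto
  then show ?thesis using assms by simp
qed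

text \<open>
  Differentiating the summand for \<open>j\<close> gives a difference of two consecutive terms of the form
  \<open>j * (n choose j) * u ^ (j - 1) * (1 - u) ^ (n - j)\<close>, so in the sum only the first one survives.
  The telescoping is done by induction on \<open>i\<close> downwards from \<open>n\<close>.
\<close>
lemma DERIV_binomial_tail:
  assumes "1 \<le> i" "i \<le> n"
  shows "(binomial_tail n i has_real_derivative
           real i * real (n choose i) * u ^ (i - 1) * (1 - u) ^ (n - i)) (at u)"
  using assms(2,1)
proof (induction i rule: inc_induct)
  case base
  have "binomial_tail n n = (\<lambda>u. u ^ n)"
    by (simp add: binomial_tail_def fun_eq_iff)
  then show ?case by (auto intro!: derivative_eq_intros)
next
  case (step i)
  have absorb: "real (Suc i) * real (n choose Suc i) = real (n - i) * real (n choose i)"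
    by (simp only: of_nat_mult[symmetric] binomial_absorption binomial_absorb_comp)
  have "binomial_tail n i
      = (\<lambda>u. real (n choose i) * u ^ i * (1 - u) ^ (n - i) + binomial_tail n (Suc i) u)"
    using step by (auto simp: fun_eq_iff intro!: binomial_tail_Suc)
  moreover have "((\<lambda>u. real (n choose i) * u ^ i * (1 - u) ^ (n - i) + binomial_tail n (Suc i) u)
      has_real_derivative
        real (n choose i) * (real i * u ^ (i - 1)) * (1 - u) ^ (n - i)
        - real (n choose i) * u ^ i * (real (n - i) * (1 - u) ^ (n - i - 1))
        + real (Suc i) * real (n choose Suc i) * u ^ (Suc i - 1) * (1 - u) ^ (n - Suc i)) (at u)"
    using step.IH by (auto intro!: derivative_eq_intros)
  ultimately show ?case
    unfolding absorb by (simp add: algebra_simps)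
qed

lemma continuous_on_binomial_tail: "continuous_on S (binomial_tail n i)"
  unfolding binomial_tail_def by (intro continuous_intros)

lemma binomial_tail_strict_mono:
  assumes "1 \<le> i" "i \<le> n" "0 \<le> a" "a < b" "b \<le> 1"
  shows "binomial_tail n i a < binomial_tail n i b"
proof (rule DERIV_pos_imp_increasing_open[OF \<open>a < b\<close>])
  fix u assume "a < u" "u < b"
  then have "0 < real i * real (n choose i) * u ^ (i - 1) * (1 - u) ^ (n - i)"
    using assms by (auto intro!: mult_pos_pos)
  then show "\<exists>y. DERIV (binomial_tail n i) u :> y \<and> 0 < y"
    using DERIV_binomial_tail[OF assms(1,2)] by blast
qed (rule continuous_on_binomial_tail)

lemma binomial_tail_mono:
  assumes "1 \<le> i" "i \<le> n" "0 \<le> a" "a \<le> b" "b \<le> 1"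
  shows "binomial_tail n i a \<le> binomial_tail n i b"
  using binomial_tail_strict_mono[OF assms(1-3), of b] assms by (cases "a = b") auto

text \<open>
  At least \<open>n - i + 1\<close> failures occur exactly when fewer than \<open>i\<close> successes do.
\<close>
lemma binomial_tail_reflect:
  assumes "1 \<le> i" "i \<le> n"
  shows "binomial_tail n (n - i + 1) (1 - u) = 1 - binomial_tail n i u"
proof -
  have "binomial_tail n (n - i + 1) (1 - u)
      = (\<Sum>j\<in>{n - i + 1..n}. real (n choose (n - j)) * u ^ (n - j) * (1 - u) ^ (n - (n - j)))"
    unfolding binomial_tail_def
    by (intro sum.cong refl) (auto simp: binomial_symmetric[symmetric])
  also have "\<dots> = (\<Sum>j<i. real (n choose j) * u ^ j * (1 - u) ^ (n - j))"
    using assms by (intro sum.reindex_bij_witness[of _ "\<lambda>j. n - j" "\<lambda>j. n - j"]) auto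
  also have "\<dots> = binomial_tail n 0 u - binomial_tail n i u"
  proof -
    have "{0..n} = {..<i} \<union> {i..n}" "{..<i} \<inter> {i..n} = {}" using assms by auto
    then show ?thesis
      by (simp add: binomial_tail_def sum.union_disjoint)
  qed
  finally show ?thesis by (simp add: binomial_tail_all)
qed

text \<open>
  This makes the \<open>THE\<close> in \<open>Med\<close> well defined for the Beta distributions.
\<close>
lemma binomial_tail_half_ex1:
  assumes "1 \<le> i" "i \<le> n"
  shows "\<exists>!m. m \<in> {0..1} \<and> binomial_tail n i m = 1 / 2"
proof -
  obtain m where "0 \<le> m" "m \<le> 1" "binomial_tail n i m = 1 / 2"
    using IVT'[of "binomial_tail n i" 0 "1/2" 1] continuous_on_binomial_tail
      binomial_tail_at_0[OF assms(1)] binomial_tail_at_1[OF assms(2)] by auto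
  moreover have "x = y" if "x \<in> {0..1}" "y \<in> {0..1}"
    "binomial_tail n i x = binomial_tail n i y" for x y
    using that binomial_tail_strict_mono[OF assms, of x y]
      binomial_tail_strict_mono[OF assms, of y x] by (cases x y rule: linorder_cases) auto
  ultimately show ?thesis by (intro ex1I[of _ m]) auto
qed


section \<open>The Beta distribution and its median\<close>

lemma beta_density_eq:
  assumes "1 \<le> i" "i \<le> n" "0 < x" "x < 1"
  shows "beta_density (real i) (real n + 1 - real i) x
    = real i * real (n choose i) * x ^ (i - 1) * (1 - x) ^ (n - i)"
proof -
  have "Gamma (real i) = fact (i - 1)" "Gamma (real n + 1 - real i) = fact (n - i)"
    "Gamma (real n + 1) = fact n"
    using assms Gamma_fact[of "i - 1", where 'a = real] Gamma_fact[of "n - i", where 'a = real]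
      Gamma_fact[of n, where 'a = real]
    by (simp_all add: of_nat_diff algebra_simps)
  moreover have "real i / fact i = 1 / fact (i - 1)"
    using assms by (simp add: fact_reduce[of i])
  ultimately have "Gamma (real i + (real n + 1 - real i))
      / (Gamma (real i) * Gamma (real n + 1 - real i)) = real i * real (n choose i)"
    using assms by (simp add: binomial_fact field_simps)
  moreover have "x powr (real i - 1) = x ^ (i - 1)"
    using assms powr_realpow[of x "i - 1"] by (simp add: of_nat_diff)
  moreover have "(1 - x) powr (real n + 1 - real i - 1) = (1 - x) ^ (n - i)"
    using assms powr_realpow[of "1 - x" "n - i"] by (simp add: of_nat_diff)
  ultimately show ?thesis
    using assms by (simp add: beta_density_def)
qed

lemma beta_density_measurable: "beta_density \<alpha> \<beta> \<in> borel_measurable borel"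
  unfolding beta_density_def[abs_def] by measurable

text \<open>
  The set is only compared with an interval inside \<open>(0,1)\<close>, since the distribution lives there
  and the endpoints are null; this covers the half-lines \<open>{..m}\<close> and \<open>{m..}\<close> for any real \<open>m\<close>.
\<close>
lemma measure_beta_distribution:
  assumes "1 \<le> i" "i \<le> n" "0 \<le> a" "a \<le> b" "b \<le> 1"
    and A: "A \<in> sets borel" "A \<inter> {0<..<1} = {a..b} \<inter> {0<..<1}"
  shows "measure (beta_distribution (real i) (real n + 1 - real i)) A
    = binomial_tail n i b - binomial_tail n i a"
proof -
  define g where "g = (\<lambda>x::real. real i * real (n choose i) * x ^ (i - 1) * (1 - x) ^ (n - i))"
  have "emeasure (beta_distribution (real i) (real n + 1 - real i)) A
      = (\<integral>\<^sup>+x. ennreal (beta_density (real i) (real n + 1 - real i) x) * indicator A x \<partial>lborel)"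
    unfolding beta_distribution_def
    using A(1) by (subst emeasure_density) (auto intro: measurable_compose[OF beta_density_measurable])
  also have "\<dots> = (\<integral>\<^sup>+x. ennreal (g x) * indicator {a..b} x \<partial>lborel)"
  proof (rule nn_integral_cong_AE)
    have "ennreal (beta_density (real i) (real n + 1 - real i) x) * indicator A x
        = ennreal (g x) * indicator {a..b} x" if "x \<noteq> 0" "x \<noteq> 1" for x
    proof (cases "x \<in> {0<..<1}")
      case True
      then have "x \<in> A \<longleftrightarrow> x \<in> {a..b}" using A(2) by blast
      then show ?thesis
        using True beta_density_eq[OF assms(1,2)] by (simp add: g_def indicator_def)
    next
      case False
      then have "beta_density (real i) (real n + 1 - real i) x = 0" "x \<notin> {a..b}"
        using that assms by (auto simp: beta_density_def)
      then show ?thesis by simp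
    qed
    moreover have "AE x in lborel. x \<noteq> (0::real) \<and> x \<noteq> 1"
      using AE_lborel_singleton[of "0::real"] AE_lborel_singleton[of "1::real"] by eventually_elim simp
    ultimately show "AE x in lborel. ennreal (beta_density (real i) (real n + 1 - real i) x) * indicator A x
        = ennreal (g x) * indicator {a..b} x"
      by (auto elim: eventually_mono)
  qed
  also have "\<dots> = ennreal (binomial_tail n i b - binomial_tail n i a)"
    using assms(3-5) DERIV_binomial_tail[OF assms(1,2)]
    by (intro nn_integral_FTC_Icc)
      (auto simp: g_def intro!: mult_nonneg_nonneg has_field_derivative_at_within)
  finally show ?thesis
    using binomial_tail_mono[OF assms(1-5)] by (simp add: measure_def)
qed

text \<open>
  There are no atoms, so the two masses in the definition of a median sum to 1, and both are
  at least one half only if both are equal to it. Clamping \<open>m\<close> to \<open>[0,1]\<close> changes neither mass.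
\<close>
lemma is_median_beta_iff:
  assumes "1 \<le> i" "i \<le> n"
  shows "is_median (beta_distribution (real i) (real n + 1 - real i)) m
    \<longleftrightarrow> m \<in> {0..1} \<and> binomial_tail n i m = 1 / 2"
proof -
  let ?c = "max 0 (min 1 m)"
  have sets: "{..m} \<inter> {0<..<1} = {0..?c} \<inter> {0<..<1}" "{m..} \<inter> {0<..<1} = {?c..1} \<inter> {0<..<1}"
    by auto
  have "measure (beta_distribution (real i) (real n + 1 - real i)) {..m} = binomial_tail n i ?c"
    using measure_beta_distribution[OF assms, of 0 ?c "{..m}"] sets(1) binomial_tail_at_0[OF assms(1)]
    by simp
  moreover have "measure (beta_distribution (real i) (real n + 1 - real i)) {m..}
      = 1 - binomial_tail n i ?c"
    using measure_beta_distribution[OF assms, of ?c 1 "{m..}"] sets(2) binomial_tail_at_1[OF assms(2)]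
    by simp
  ultimately have "is_median (beta_distribution (real i) (real n + 1 - real i)) m
      \<longleftrightarrow> binomial_tail n i ?c = 1 / 2"
    by (auto simp: is_median_def)
  also have "\<dots> \<longleftrightarrow> m \<in> {0..1} \<and> binomial_tail n i m = 1 / 2"
    using binomial_tail_at_0[OF assms(1)] binomial_tail_at_1[OF assms(2)]
    by (auto simp: max_def min_def)
  finally show ?thesis .
qed

lemma Med_beta:
  assumes "1 \<le> i" "i \<le> n"
  defines "m \<equiv> Med (beta_distribution (real i) (real n + 1 - real i))"
  shows "m \<in> {0..1}" "binomial_tail n i m = 1 / 2"
proof -
  have "m \<in> {0..1} \<and> binomial_tail n i m = 1 / 2"
    unfolding m_def Med_def is_median_beta_iff[OF assms(1,2)]
    by (rule theI'[OF binomial_tail_half_ex1[OF assms(1,2)]])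
  then show "m \<in> {0..1}" "binomial_tail n i m = 1 / 2" by auto
qed


section \<open>Distribution of an order statistic\<close>

text \<open>
  In a sorted list the entries below a threshold form an initial segment.
\<close>
lemma nth_sorted_le_iff:
  fixes xs :: "'a::linorder list"
  assumes "sorted xs" "k < length xs"
  shows "xs ! k \<le> x \<longleftrightarrow> k < length (filter (\<lambda>y. y \<le> x) xs)"
  using assms
proof (induction xs arbitrary: k)
  case (Cons a xs)
  show ?case
  proof (cases "a \<le> x")
    case True
    then show ?thesis using Cons by (cases k) auto
  next
    case False
    then have "\<forall>y\<in>set (a # xs). \<not> y \<le> x"
      using Cons.prems(1) by (auto dest: order_trans)
    then show ?thesis
      using Cons.prems(2) nth_mem[of k "a # xs"] by (auto simp: filter_empty_conv)
  qed
qed simp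

lemma order_statistic_le_iff:
  assumes "i \<in> {1..n}"
  shows "order_statistic n Xs i \<omega> \<le> x \<longleftrightarrow> i \<le> card {k\<in>{1..n}. Xs k \<omega> \<le> x}"
proof -
  let ?xs = "map (\<lambda>k. Xs k \<omega>) [1..<Suc n]"
  have "order_statistic n Xs i \<omega> \<le> x \<longleftrightarrow> i - 1 < length (filter (\<lambda>y. y \<le> x) (sort ?xs))"
    unfolding order_statistic_def using assms by (intro nth_sorted_le_iff) auto
  also have "length (filter (\<lambda>y. y \<le> x) (sort ?xs))
      = length (filter (\<lambda>k. Xs k \<omega> \<le> x) [1..<Suc n])"
    by (simp add: filter_sort filter_map o_def del: upt_Suc)
  also have "\<dots> = card {k\<in>{1..n}. Xs k \<omega> \<le> x}"
  proof -
    have "set (filter (\<lambda>k. Xs k \<omega> \<le> x) [1..<Suc n]) = {k\<in>{1..n}. Xs k \<omega> \<le> x}" by auto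
    then show ?thesis
      by (metis distinct_card distinct_filter distinct_upt)
  qed
  finally show ?thesis using assms by auto
qed

text \<open>
  The event that the successes \<open>Xs k \<le> x\<close> occur precisely at the indices in \<open>S\<close> is an
  intersection of preimages of half-lines, one for each index, so independence applies to it.
\<close>
lemma (in prob_space) prob_exact_success_set:
  assumes indep: "indep_vars (\<lambda>_. borel) Xs I" and I: "finite I" "I \<noteq> {}"
    and u: "\<And>k. k \<in> I \<Longrightarrow> cdf (distr M borel (Xs k)) x = u"
    and S: "S \<subseteq> I"
  shows "prob {\<omega>\<in>space M. {k\<in>I. Xs k \<omega> \<le> x} = S} = u ^ card S * (1 - u) ^ card (I - S)"
    and "{\<omega>\<in>space M. {k\<in>I. Xs k \<omega> \<le> x} = S} \<in> events"
proof -
  have rv: "Xs k \<in> borel_measurable M" if "k \<in> I" for k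
    using indep that by (auto simp: indep_vars_def)
  define B where "B k = (if k \<in> S then {..x} else {x<..})" for k
  have eq: "{\<omega>\<in>space M. {k\<in>I. Xs k \<omega> \<le> x} = S} = (\<Inter>k\<in>I. Xs k -` B k \<inter> space M)"
    using S I(2) by (auto simp: B_def not_le split: if_splits)
  have le: "prob (Xs k -` {..x} \<inter> space M) = u" if "k \<in> I" for k
    using u[OF that] rv[OF that] by (simp add: cdf_def measure_distr)
  have gt: "prob (Xs k -` {x<..} \<inter> space M) = 1 - u" if "k \<in> I" for k
  proof -
    have "Xs k -` {x<..} \<inter> space M = space M - (Xs k -` {..x} \<inter> space M)" by auto
    then show ?thesis
      using le[OF that] rv[OF that] by (simp add: prob_compl measurable_sets)
  qed
  have "prob {\<omega>\<in>space M. {k\<in>I. Xs k \<omega> \<le> x} = S} = (\<Prod>k\<in>I. prob (Xs k -` B k \<inter> space M))"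
    unfolding eq by (rule indep_varsD_finite[OF indep]) (use I in \<open>auto simp: B_def\<close>)
  also have "\<dots> = (\<Prod>k\<in>I. if k \<in> S then u else 1 - u)"
    by (intro prod.cong refl) (auto simp: B_def le gt)
  also have "\<dots> = u ^ card S * (1 - u) ^ card (I - S)"
    using S I(1) by (simp add: prod.If_cases Int_absorb1 Diff_eq)
  finally show "prob {\<omega>\<in>space M. {k\<in>I. Xs k \<omega> \<le> x} = S} = u ^ card S * (1 - u) ^ card (I - S)" .
  show "{\<omega>\<in>space M. {k\<in>I. Xs k \<omega> \<le> x} = S} \<in> events"
    unfolding eq using I rv by (intro sets.finite_INT measurable_sets) (auto simp: B_def)
qed

text \<open>
  The event is split by the exact set of successes, and these sets are then grouped by their size.
\<close>
lemma (in prob_space) prob_order_statistic_le: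
  assumes indep: "indep_vars (\<lambda>_. borel) Xs {1..n}"
    and u: "\<And>k. k \<in> {1..n} \<Longrightarrow> cdf (distr M borel (Xs k)) x = u"
    and i: "i \<in> {1..n}"
  shows "prob {\<omega>\<in>space M. order_statistic n Xs i \<omega> \<le> x} = binomial_tail n i u"
    and "{\<omega>\<in>space M. order_statistic n Xs i \<omega> \<le> x} \<in> events"
proof -
  let ?E = "\<lambda>S. {\<omega>\<in>space M. {k\<in>{1..n}. Xs k \<omega> \<le> x} = S}"
  define T where "T = {S. S \<subseteq> {1..n} \<and> i \<le> card S}"
  have T: "finite T" unfolding T_def by (rule finite_subset[of _ "Pow {1..n}"]) auto
  have ev: "?E S \<in> events" and pr: "prob (?E S) = u ^ card S * (1 - u) ^ (n - card S)"
    if "S \<in> T" for S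
  proof -
    have "S \<subseteq> {1..n}" using that by (simp add: T_def)
    then show "?E S \<in> events" "prob (?E S) = u ^ card S * (1 - u) ^ (n - card S)"
      using prob_exact_success_set[OF indep _ _ u] i
      by (simp_all add: card_Diff_subset finite_subset)
  qed
  have eq: "{\<omega>\<in>space M. order_statistic n Xs i \<omega> \<le> x} = (\<Union>S\<in>T. ?E S)"
    by (auto simp: order_statistic_le_iff[OF i] T_def)
  show "{\<omega>\<in>space M. order_statistic n Xs i \<omega> \<le> x} \<in> events"
    unfolding eq using T ev by (intro sets.finite_UN) auto
  have "prob {\<omega>\<in>space M. order_statistic n Xs i \<omega> \<le> x} = (\<Sum>S\<in>T. prob (?E S))"
    unfolding eq using T ev
    by (intro finite_measure_finite_Union) (auto simp: disjoint_family_on_def)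
  also have "\<dots> = (\<Sum>S\<in>T. u ^ card S * (1 - u) ^ (n - card S))"
    by (intro sum.cong refl pr)
  also have "\<dots> = (\<Sum>j\<in>{i..n}. \<Sum>S\<in>{S\<in>T. card S = j}. u ^ card S * (1 - u) ^ (n - card S))"
  proof (rule sum.group[symmetric])
    show "card ` T \<subseteq> {i..n}"
      using card_mono[of "{1..n}"] by (fastforce simp: T_def)
  qed (use T in auto)
  also have "\<dots> = (\<Sum>j\<in>{i..n}. real (card {S\<in>T. card S = j}) * (u ^ j * (1 - u) ^ (n - j)))"
    by (intro sum.cong refl) simp
  also have "\<dots> = binomial_tail n i u"
    unfolding binomial_tail_def
  proof (intro sum.cong refl)
    fix j assume "j \<in> {i..n}"
    then have "{S\<in>T. card S = j} = {S. S \<subseteq> {1..n} \<and> card S = j}" by (auto simp: T_def)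
    then show "real (card {S\<in>T. card S = j}) * (u ^ j * (1 - u) ^ (n - j))
        = real (n choose j) * u ^ j * (1 - u) ^ (n - j)"
      by (simp add: n_subsets)
  qed
  finally show "prob {\<omega>\<in>space M. order_statistic n Xs i \<omega> \<le> x} = binomial_tail n i u" .
qed

lemma (in prob_space) order_statistic_measurable:
  assumes "indep_vars (\<lambda>_. borel) Xs {1..n}" "i \<in> {1..n}"
    and "\<And>k. k \<in> {1..n} \<Longrightarrow> cdf (distr M borel (Xs k)) = F"
  shows "order_statistic n Xs i \<in> borel_measurable M"
  unfolding borel_measurable_iff_le
  using prob_order_statistic_le(2)[OF assms(1) _ assms(2)] assms(3) by auto


section \<open>Quantiles and the probability loss for a continuous distribution function\<close>

text \<open>
  For a level \<open>u\<close> strictly between two values of \<open>F\<close>, the set \<open>{y. F y \<le> u}\<close> is a closed half-line;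
  its endpoint transfers the event \<open>F Y \<le> u\<close> to an event \<open>Y \<le> x\<close> even where \<open>F\<close> is not injective.
\<close>
lemma continuous_cdf_level:
  fixes F :: "real \<Rightarrow> real"
  assumes cont: "continuous_on UNIV F" and mono: "mono F"
    and lo: "F a < u" and hi: "u < F b"
  obtains x where "F x = u" "\<And>y. F y \<le> u \<longleftrightarrow> y \<le> x"
proof -
  have "a \<le> b"
    using lo hi monoD[OF mono, of b a] by linarith
  then obtain z where z: "F z = u"
    using IVT'[of F a u b] lo hi continuous_on_subset[OF cont] by auto
  let ?S = "{y. F y \<le> u}"
  have "?S \<noteq> {}" using z by auto
  moreover have bdd: "bdd_above ?S"
  proof (rule bdd_aboveI)
    fix y assume "y \<in> ?S"
    then show "y \<le> b" using hi monoD[OF mono, of b y] by force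
  qed
  moreover have "closed ?S"
    by (intro closed_Collect_le cont continuous_on_const)
  ultimately have "Sup ?S \<in> ?S" by (rule closed_contains_Sup)
  then have "F (Sup ?S) \<le> u" by simp
  moreover have "u \<le> F (Sup ?S)"
    using z cSup_upper[OF _ bdd, of z] monoD[OF mono, of z "Sup ?S"] by auto
  ultimately have "F (Sup ?S) = u" by simp
  moreover have "F y \<le> u \<longleftrightarrow> y \<le> Sup ?S" for y
    using cSup_upper[OF _ bdd, of y] \<open>F (Sup ?S) = u\<close> monoD[OF mono, of y "Sup ?S"] by auto
  ultimately show thesis by (rule that)
qed

text \<open>
  The quantile is infinite only where the conventions \<open>F (-\<infinity>) = 0\<close> and \<open>F \<infinity> = 1\<close> fit its level.
  Elsewhere the infimum is attained, because \<open>F\<close> is continuous, and \<open>F\<close> takes the value \<open>p\<close> there.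
  If \<open>F\<close> attains the value 1, the case \<open>p = 1\<close> falls under the finite quantiles.
\<close>
lemma quantile_cases:
  fixes F :: "real \<Rightarrow> real"
  assumes cont: "continuous_on UNIV F" and mono: "mono F"
    and bot: "(F \<longlongrightarrow> 0) at_bot" and top: "(F \<longlongrightarrow> 1) at_top"
    and range: "\<And>x. 0 \<le> F x" and p: "p \<in> {0..1}"
  obtains "p = 0" "quantile F p = -\<infinity>"
    | "p = 1" "quantile F p = \<infinity>"
    | x where "F x = p" "quantile F p = ereal x"
proof -
  consider "p = 0" | "p = 1" "\<And>x. F x < 1" | b where "0 < p" "p \<le> F b"
  proof (cases "p < 1")
    case True
    then obtain b where "p < F b"
      using order_tendstoD(1)[OF top] by (auto simp: eventually_at_top_linorder)
    then show ?thesis using p that(1) that(3)[of b] by (cases "p = 0") auto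
  next
    case False
    with p have "p = 1" by simp
    show ?thesis
    proof (cases "\<exists>b. 1 \<le> F b")
      case True
      then show ?thesis using that(3) \<open>p = 1\<close> by auto
    next
      case False
      then show ?thesis using that(2) \<open>p = 1\<close> by (auto simp: not_le)
    qed
  qed
  then show thesis
  proof cases
    case 1
    have "quantile F p \<le> ereal x" for x
      unfolding quantile_def using range 1 by (intro INF_lower) auto
    then have "quantile F p = -\<infinity>"
      by (rule ereal_bot)
    then show thesis using 1 that by blast
  next
    case 2
    then have "{x. p \<le> F x} = {}" by (auto simp: not_le)
    then have "quantile F p = \<infinity>" by (simp add: quantile_def top_ereal_def)
    then show thesis using 2 that by blast
  next
    case 3
    obtain a where a: "F a < p"
      using order_tendstoD(2)[OF bot \<open>0 < p\<close>] by (auto simp: eventually_at_bot_linorder)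
    have "a \<le> b"
      using a 3 monoD[OF mono, of b a] by linarith
    then obtain z where z: "F z = p"
      using IVT'[of F a p b] a 3 continuous_on_subset[OF cont] by auto
    let ?S = "{y. p \<le> F y}"
    have ne: "?S \<noteq> {}" using z by auto
    have bdd: "bdd_below ?S"
    proof (rule bdd_belowI)
      fix y assume "y \<in> ?S"
      then show "a \<le> y" using a monoD[OF mono, of y a] by force
    qed
    have "closed ?S"
      by (intro closed_Collect_le cont continuous_on_const)
    then have "Inf ?S \<in> ?S" using ne bdd by (intro closed_contains_Inf)
    moreover have "F (Inf ?S) \<le> p"
      using z cInf_lower[OF _ bdd, of z] monoD[OF mono, of "Inf ?S" z] by auto
    ultimately have "F (Inf ?S) = p" by auto
    moreover have "quantile F p = ereal (Inf ?S)"
      unfolding quantile_def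
      using \<open>Inf ?S \<in> ?S\<close> by (intro antisym INF_lower INF_greatest) (auto intro: cInf_lower[OF _ bdd])
    ultimately show thesis using that by blast
  qed
qed

text \<open>
  A continuous distribution function has no atoms, so the strict inequalities in the loss cost
  nothing, and at most one of its two summands is nonzero.
\<close>
lemma (in prob_space) prob_loss_quantile:
  assumes X: "X \<in> borel_measurable M" and F: "cdf (distr M borel X) = F"
    and cont: "continuous_on UNIV F" and p: "p \<in> {0..1}"
  shows "prob_loss M X (ereal a) (quantile F p) = \<bar>F a - p\<bar>"
proof -
  interpret D: real_distribution "distr M borel X"
    using X by (rule real_distribution_distr)
  have le: "prob {\<omega>\<in>space M. X \<omega> \<le> x} = F x" for x
    using X by (simp add: F[symmetric] cdf_def measure_distr vimage_def Int_def conj_commute)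
  have point: "prob {\<omega>\<in>space M. X \<omega> = x} = 0" for x
  proof -
    have "isCont F x" using cont by (simp add: continuous_on_eq_continuous_at)
    then have "measure (distr M borel X) {x} = 0" by (simp add: D.isCont_cdf[symmetric] F)
    then show ?thesis using X by (simp add: measure_distr vimage_def Int_def conj_commute)
  qed
  have less: "prob {\<omega>\<in>space M. X \<omega> < x} = F x" for x
  proof -
    have "prob {\<omega>\<in>space M. X \<omega> \<le> x}
        = prob {\<omega>\<in>space M. X \<omega> < x} + prob {\<omega>\<in>space M. X \<omega> = x}"
      using X by (subst finite_measure_Union[symmetric]) (auto intro!: arg_cong[where f = prob])
    then show ?thesis using le point by simp
  qed
  have between: "prob {\<omega>\<in>space M. x < X \<omega> \<and> X \<omega> < y} = max 0 (F y - F x)" for x y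
  proof (cases "x < y")
    case True
    have "prob {\<omega>\<in>space M. X \<omega> < y}
        = prob {\<omega>\<in>space M. X \<omega> \<le> x} + prob {\<omega>\<in>space M. x < X \<omega> \<and> X \<omega> < y}"
      using X True by (subst finite_measure_Union[symmetric]) (auto intro!: arg_cong[where f = prob])
    moreover have "0 \<le> prob {\<omega>\<in>space M. x < X \<omega> \<and> X \<omega> < y}" by simp
    ultimately show ?thesis
      using le less by (simp add: max_def)
  next
    case False
    then have "{\<omega>\<in>space M. x < X \<omega> \<and> X \<omega> < y} = {}" by auto
    then have "prob {\<omega>\<in>space M. x < X \<omega> \<and> X \<omega> < y} = 0" by (simp only: measure_empty)
    moreover have "F y \<le> F x" using D.cdf_nondecreasing[of y x] False by (simp add: F)
    ultimately show ?thesis by simp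
  qed
  have greater: "prob {\<omega>\<in>space M. x < X \<omega>} = 1 - F x" for x
  proof -
    have "{\<omega>\<in>space M. x < X \<omega>} = space M - {\<omega>\<in>space M. X \<omega> \<le> x}" by auto
    then show ?thesis using X le by (simp add: prob_compl)
  qed
  have F01: "0 \<le> F x" "F x \<le> 1" for x
    unfolding le[symmetric] by simp_all
  have "mono F" using D.cdf_nondecreasing by (auto simp: mono_def F)
  have lims: "(F \<longlongrightarrow> 0) at_bot" "(F \<longlongrightarrow> 1) at_top"
    using D.cdf_lim_at_bot D.cdf_lim_at_top_prob by (simp_all add: F)
  show ?thesis
  proof (cases rule: quantile_cases[OF cont \<open>mono F\<close> lims F01(1) p])
    case 1
    then show ?thesis using less F01 by (simp add: prob_loss_def)
  next
    case 2
    then show ?thesis using greater F01 by (simp add: prob_loss_def)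
  next
    case (3 x)
    then show ?thesis using between by (simp add: prob_loss_def)
  qed
qed


section \<open>The median minimizes the expected absolute deviation\<close>

text \<open>
  Let \<open>q > m\<close>, the other side being symmetric, and let \<open>r\<close> be the midpoint of \<open>m\<close> and \<open>q\<close>.
  The gain \<open>\<bar>U - q\<bar> - \<bar>U - m\<bar>\<close> equals \<open>q - m\<close> where \<open>U \<le> m\<close>, is nonnegative where
  \<open>m < U \<le> r\<close>, and is at least \<open>-(q - m)\<close> elsewhere. Hence its expectation is at least
  \<open>(q - m) * (P(U \<le> m) + P(U \<le> r) - 1)\<close>, which is positive as soon as there is mass
  between \<open>m\<close> and \<open>r\<close>. The midpoint is what makes the minimizer unique: the cruder bound
  that uses \<open>m\<close> alone would only give a nonnegative difference.
\<close>
lemma (in prob_space) abs_deviation_median_less: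
  fixes U :: "'a \<Rightarrow> real"
  assumes int: "integrable M U"
    and med: "prob {\<omega>\<in>space M. U \<omega> \<le> m} = 1 / 2"
    and left: "q < m \<Longrightarrow> prob {\<omega>\<in>space M. U \<omega> \<le> (m + q) / 2} < 1 / 2"
    and right: "m < q \<Longrightarrow> 1 / 2 < prob {\<omega>\<in>space M. U \<omega> \<le> (m + q) / 2}"
    and "q \<noteq> m"
  shows "(\<integral>\<omega>. \<bar>U \<omega> - m\<bar> \<partial>M) < (\<integral>\<omega>. \<bar>U \<omega> - q\<bar> \<partial>M)"
proof -
  have [measurable]: "U \<in> borel_measurable M" using int by auto
  define A where "A x = {\<omega>\<in>space M. U \<omega> \<le> x}" for x
  have A[measurable]: "A x \<in> events" for x unfolding A_def by measurable
  define r where "r = (m + q) / 2"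
  \<comment> \<open>One formula for both signs of \<open>q - m\<close>: for \<open>q < m\<close> the sets \<open>A m\<close> and \<open>A r\<close> swap roles.\<close>
  let ?h = "\<lambda>\<omega>. (q - m) * (indicat_real (A m) \<omega> + indicat_real (A r) \<omega> - 1)"
  have "?h \<omega> \<le> \<bar>U \<omega> - q\<bar> - \<bar>U \<omega> - m\<bar>" if "\<omega> \<in> space M" for \<omega>
    using that by (auto simp: A_def indicator_def r_def abs_if field_simps)
  moreover have "integrable M ?h"
    by (intro integrable_mult_right integrable_diff integrable_add integrable_const)
      (auto intro!: integrable_real_indicator simp: emeasure_eq_measure)
  moreover have "integrable M (\<lambda>\<omega>. \<bar>U \<omega> - q\<bar> - \<bar>U \<omega> - m\<bar>)"
    using int by simp
  ultimately have "(\<integral>\<omega>. ?h \<omega> \<partial>M) \<le> (\<integral>\<omega>. \<bar>U \<omega> - q\<bar> - \<bar>U \<omega> - m\<bar> \<partial>M)"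
    by (intro integral_mono)
  moreover have "(\<integral>\<omega>. ?h \<omega> \<partial>M) = (q - m) * (prob (A m) + prob (A r) - 1)"
    by (simp add: prob_space emeasure_eq_measure)
  moreover have "0 < (q - m) * (prob (A m) + prob (A r) - 1)"
    using med left right \<open>q \<noteq> m\<close>
    by (cases "q < m") (auto simp: A_def r_def intro: mult_pos_pos mult_neg_neg)
  moreover have "(\<integral>\<omega>. \<bar>U \<omega> - q\<bar> - \<bar>U \<omega> - m\<bar> \<partial>M)
      = (\<integral>\<omega>. \<bar>U \<omega> - q\<bar> \<partial>M) - (\<integral>\<omega>. \<bar>U \<omega> - m\<bar> \<partial>M)"
    using int by simp
  ultimately show ?thesis by linarith
qed


section \<open>Expected probability loss of an order statistic\<close>

theorem theorem2p1:
  fixes M :: "'a measure" and N :: "'b measure"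
    and Xs :: "nat \<Rightarrow> 'a \<Rightarrow> real" and X :: "'b \<Rightarrow> real"
    and F :: "real \<Rightarrow> real" and n i :: nat and p :: "nat \<Rightarrow> real"
  assumes "prob_space M"
    and "prob_space.indep_vars M (\<lambda>_. borel) Xs {1..n}"
    and "\<And>k. k \<in> {1..n} \<Longrightarrow> cdf (distr M borel (Xs k)) = F"
    and "continuous_on UNIV F"
    and "prob_space N"
    and "X \<in> borel_measurable N"
    and "cdf (distr N borel X) = F"
    and p_def: "\<And>j. p j = Med (beta_distribution (real j) (real n + 1 - real j))"
    and "i \<in> {1..n}"
  shows "p i \<in> {0..1} \<and>
    (\<forall>q\<in>{0..1}. q \<noteq> p i \<longrightarrow>
       expected_prob_loss M n Xs N X i (p i) < expected_prob_loss M n Xs N X i q) \<and>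
    (\<forall>u\<in>{0..1}. (\<Sum>j=i..n. real (n choose j) * u ^ j * (1 - u) ^ (n - j)) = 1 / 2
       \<longleftrightarrow> u = p i) \<and>
    p i = 1 - p (n - i + 1)"
proof (intro conjI ballI impI)
  interpret M: prob_space M by fact
  interpret N: prob_space N by fact
  interpret D: real_distribution "distr N borel X"
    using assms(6) by (rule N.real_distribution_distr)
  have i: "1 \<le> i" "i \<le> n" using assms(9) by auto
  have p01: "p j \<in> {0..1}" and p_half: "binomial_tail n j (p j) = 1 / 2" if "1 \<le> j" "j \<le> n" for j
    unfolding p_def using Med_beta[OF that] by auto
  show "p i \<in> {0..1}" by (rule p01[OF i])

  have unique: "u = p i" if "u \<in> {0..1}" "binomial_tail n i u = 1 / 2" for u
    using binomial_tail_half_ex1[OF i] that p01[OF i] p_half[OF i] by blast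
  show "(\<Sum>j=i..n. real (n choose j) * u ^ j * (1 - u) ^ (n - j)) = 1 / 2 \<longleftrightarrow> u = p i"
    if "u \<in> {0..1}" for u
    using unique[OF that] p_half[OF i] by (auto simp: binomial_tail_def)

  have "binomial_tail n i (1 - p (n - i + 1)) = 1 / 2"
    using binomial_tail_reflect[OF i, of "1 - p (n - i + 1)"] p_half[of "n - i + 1"] i by simp
  moreover have "1 - p (n - i + 1) \<in> {0..1}"
    using p01[of "n - i + 1"] i by auto
  ultimately show "p i = 1 - p (n - i + 1)" by (metis unique)

  \<comment> \<open>The law of \<open>U\<close> below is only computed at levels in the open interval, where \<open>F\<close> has values
    on both sides.\<close>
  have p_open: "0 < p i" "p i < 1"
    using p01[OF i] p_half[OF i] binomial_tail_at_0[OF i(1)] binomial_tail_at_1[OF i(2)]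
    by (force simp: less_le)+

  have mono: "mono F" using D.cdf_nondecreasing assms(7) by (auto simp: mono_def)
  have lims: "(F \<longlongrightarrow> 0) at_bot" "(F \<longlongrightarrow> 1) at_top"
    using D.cdf_lim_at_bot D.cdf_lim_at_top_prob assms(7) by simp_all
  define U where "U \<omega> = F (order_statistic n Xs i \<omega>)" for \<omega>
  have loss: "expected_prob_loss M n Xs N X i q = (\<integral>\<omega>. \<bar>U \<omega> - q\<bar> \<partial>M)" if "q \<in> {0..1}" for q
    using N.prob_loss_quantile[OF assms(6,7,4) that]
    by (simp add: expected_prob_loss_def assms(7) U_def)
  have U_cdf: "M.prob {\<omega>\<in>space M. U \<omega> \<le> u} = binomial_tail n i u" if u: "0 < u" "u < 1" for u
  proof -
    obtain a b where "F a < u" "u < F b"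
      using order_tendstoD(2)[OF lims(1) u(1)] order_tendstoD(1)[OF lims(2) u(2)]
      by (auto simp: eventually_at_bot_linorder eventually_at_top_linorder)
    then obtain x where x: "F x = u" "\<And>y. F y \<le> u \<longleftrightarrow> y \<le> x"
      using continuous_cdf_level[OF assms(4) mono] by blast
    then show ?thesis
      unfolding U_def x(2)
      by (intro M.prob_order_statistic_le(1)[OF assms(2)]) (use assms(3,9) in auto)
  qed
  have U_meas: "U \<in> borel_measurable M"
    unfolding U_def
    by (rule measurable_compose[OF M.order_statistic_measurable[OF assms(2,9,3)]
          borel_measurable_continuous_onI[OF assms(4)]])
  have "0 \<le> F x" "F x \<le> 1" for x
    using D.cdf_bounded_prob[of x] measure_nonneg[of "distr N borel X" "{..x}"]
    by (simp_all add: assms(7)[symmetric] cdf_def)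
  then have U_int: "integrable M U"
    using U_meas by (intro M.integrable_const_bound[of _ 1]) (auto simp: U_def)

  fix q :: real assume q: "q \<in> {0..1}" "q \<noteq> p i"
  \<comment> \<open>Even for \<open>q\<close> equal to 0 or 1, the midpoint is a level in the open interval.\<close>
  have r: "0 < (p i + q) / 2" "(p i + q) / 2 < 1" using p_open q(1) by auto
  have "(\<integral>\<omega>. \<bar>U \<omega> - p i\<bar> \<partial>M) < (\<integral>\<omega>. \<bar>U \<omega> - q\<bar> \<partial>M)"
  proof (rule M.abs_deviation_median_less[OF U_int _ _ _ q(2)])
    show "M.prob {\<omega>\<in>space M. U \<omega> \<le> p i} = 1 / 2"
      using U_cdf[OF p_open] p_half[OF i] by simp
    show "M.prob {\<omega>\<in>space M. U \<omega> \<le> (p i + q) / 2} < 1 / 2" if "q < p i"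
      using U_cdf[OF r] binomial_tail_strict_mono[OF i, of "(p i + q) / 2" "p i"] that r p_open
        p_half[OF i] by simp
    show "1 / 2 < M.prob {\<omega>\<in>space M. U \<omega> \<le> (p i + q) / 2}" if "p i < q"
      using U_cdf[OF r] binomial_tail_strict_mono[OF i, of "p i" "(p i + q) / 2"] that r p_open
        p_half[OF i] by simp
  qed
  then show "expected_prob_loss M n Xs N X i (p i) < expected_prob_loss M n Xs N X i q"
    using loss q(1) p01[OF i] by simp
qed

end
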